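(* Let $\mu$ be a cardinal, $\mathbb{P}$ a poset, $\langle Q_{\alpha,\varepsilon}: \alpha<\mu,\ \varepsilon\in(0,1)\cap\mathbb{Q}\rangle$ a sequence of subsets of $\mathbb{P}$, $\mathcal{D}\subseteq\mathcal{D}_*$, and for each $(D,\bar I)\in\mathcal{D}$ (with $\bar I=\langle I_k:k\in K\rangle$, $W=\bigcup_{k\in K}I_k$), each $\alpha<\mu$ and each $\varepsilon\in(0,1)\cap\mathbb{Q}$, let $\lim^{D,\bar I}\colon Q_{\alpha,\varepsilon}^W\to\mathbb{P}$ be a function. Then the following are equivalent. (I) $\mathbb{P}$ is uniformly $\mu$-$\mathcal{D}$-linked witnessed by $\langle Q_{\alpha,\varepsilon}\rangle$ and these limit functions, i.e.: for each $\varepsilon\in(0,1)\cap\mathbb{Q}$, $\bigcup_{\alpha<\mu}Q_{\alpha,\varepsilon}$ is dense in $\mathbb{P}$, and for each $(D,\bar I)\in\mathcal{D}$ there is a $\mathbb{P}$-name $\dot D'$ of an ultrafilter on $\mathcal{P}(K)$ extending $D$ such that for all $\alpha<\mu$, $\varepsilon\in(0,1)\cap\mathbb{Q}$ and $\bar p=\langle p_\ell:\ell\in W\rangle\in Q_{\alpha,\varepsilon}^W$, \[\lim\nolimits^{D,\bar I}\bar p\Vdash \left\{k\in K: \frac{|\{\ell\in I_k: p_\ell\in\dot G\}|}{|I_k|}\ge 1-\varepsilon\right\}\in\dot D'.\] (II) For each $\varepsilon\in(0,1)\cap\mathbb{Q}$, $\bigcup_{\alpha<\mu}Q_{\alpha,\varepsilon}$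 is dense in $\mathbb{P}$, and for any $(D,\bar I)\in\mathcal{D}$, any $i^*<\omega$, any $(\alpha_i,\varepsilon_i)\in\mu\times((0,1)\cap\mathbb{Q})$ and $\bar r^i=\langle r^i_\ell:\ell\in W\rangle\in Q_{\alpha_i,\varepsilon_i}^W$ for $i<i^*$, any $a\in D$, and any $q\in\mathbb{P}$ with $q\le\lim^{D,\bar I}\bar r^i$ for all $i<i^*$, there are $q'\le q$ in $\mathbb{P}$ and $k\in a$ such that for all $i<i^*$, \[\frac{|\{\ell\in I_k: q'\le r^i_\ell\}|}{|I_k|}\ge 1-\varepsilon_i.\]
   Context: $\mathcal{D}_*$ is the class of all pairs $(D,\bar I)$ where $D$ is an ultrafilter on $\mathcal{P}(K)$ for some non-empty set $K$ and $\bar I=\langle I_k: k\in K\rangle$ is a pairwise disjoint family of finite non-empty sets. "$\dot D'$ extends $D$" means that in the extension $\dot D'$ is an ultrafilter on the (new) power set of $K$ containing every member of $D$. $\dot G$ denotes the canonical name of the generic filter. *)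

theory Defs
  imports Complex_Main "HOL-Library.FuncSet" "HOL-Library.Disjoint_Sets"
begin

section \<open>The forcing relation\<close>

text \<open>
  The forcing notion is the carrier of a type \<open>'p\<close> of class \<open>preorder\<close>, stronger conditions being
  smaller. A sentence of the forcing language is identified with the set of conditions forcing it,
  and the connectives follow the usual recursion for the forcing relation. Disjunction and the
  existential quantifier are defined from the other connectives.
\<close>

type_synonym 'p sentence = "'p \<Rightarrow> bool"

definition forces :: "'p::preorder \<Rightarrow> 'p sentence \<Rightarrow> bool"  (infix "\<tturnstile>" 15)
  where "(p \<tturnstile> \<phi>) \<longleftrightarrow> \<phi> p"

definition fneg :: "'p::preorder sentence \<Rightarrow> 'p sentence"  ("\<^bold>\<not> _" [40] 40)
  where "(\<^bold>\<not> \<phi>) = (\<lambda>p. \<forall>q\<le>p. \<not> (q \<tturnstile> \<phi>))"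

definition fconj :: "'p::preorder sentence \<Rightarrow> 'p sentence \<Rightarrow> 'p sentence"  (infixr "\<^bold>\<and>" 35)
  where "(\<phi> \<^bold>\<and> \<psi>) = (\<lambda>p. (p \<tturnstile> \<phi>) \<and> (p \<tturnstile> \<psi>))"

definition fdisj :: "'p::preorder sentence \<Rightarrow> 'p sentence \<Rightarrow> 'p sentence"  (infixr "\<^bold>\<or>" 30)
  where "(\<phi> \<^bold>\<or> \<psi>) = (\<^bold>\<not> (\<^bold>\<not> \<phi> \<^bold>\<and> \<^bold>\<not> \<psi>))"

definition fimp :: "'p::preorder sentence \<Rightarrow> 'p sentence \<Rightarrow> 'p sentence"  (infixr "\<^bold>\<longrightarrow>" 25)
  where "(\<phi> \<^bold>\<longrightarrow> \<psi>) = (\<^bold>\<not> (\<phi> \<^bold>\<and> \<^bold>\<not> \<psi>))"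

definition fiff :: "'p::preorder sentence \<Rightarrow> 'p sentence \<Rightarrow> 'p sentence"  (infixr "\<^bold>\<longleftrightarrow>" 25)
  where "(\<phi> \<^bold>\<longleftrightarrow> \<psi>) = ((\<phi> \<^bold>\<longrightarrow> \<psi>) \<^bold>\<and> (\<psi> \<^bold>\<longrightarrow> \<phi>))"

definition fall :: "('x \<Rightarrow> 'p::preorder sentence) \<Rightarrow> 'p sentence"  (binder "\<^bold>\<forall>" 10)
  where "fall \<Phi> = (\<lambda>p. \<forall>x. p \<tturnstile> \<Phi> x)"

definition fex :: "('x \<Rightarrow> 'p::preorder sentence) \<Rightarrow> 'p sentence"  (binder "\<^bold>\<exists>" 10)
  where "(\<^bold>\<exists>x. \<Phi> x) = (\<^bold>\<not> (\<^bold>\<forall>x. \<^bold>\<not> \<Phi> x))"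

definition ground :: "bool \<Rightarrow> 'p::preorder sentence"
  where "ground b = (\<lambda>p. b)"


section \<open>Names\<close>

text \<open>
  As in set theory, a name is a set of pairs of a name (for a potential element) and a condition.
  Two levels above the ground model are needed. Elements \<open>x :: 'x\<close> of the ground model stand for
  their own canonical names, so \<open>('x, 'p) name\<close> is the type of (nice) names of sets of ground-model
  objects; every set of ground-model objects in the extension has such a name. Consequently
  \<open>(('x, 'p) name, 'p) name\<close> is the type of names of families of such sets.
  A quantifier over \<open>('x, 'p) name\<close> ranges over all subsets, in the extension, of the ground-model
  set \<open>UNIV :: 'x set\<close>.
\<close>

type_synonym ('x, 'p) name = "('x \<times> 'p) set"

text \<open>
  The forcing relation for \<open>x \<in> A\<close>, given the one for equality with \<open>x\<close>:
  the set of all \<open>r\<close> such that \<open>r \<le> s\<close> and \<open>r\<close> forces \<open>x = y\<close> for some \<open>(y, s) \<in> A\<close>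
  is dense below the condition.
\<close>

definition fmem_by :: "('x \<Rightarrow> 'x \<Rightarrow> 'p::preorder sentence) \<Rightarrow> 'x \<Rightarrow> ('x, 'p) name \<Rightarrow> 'p sentence"
  where "fmem_by E x A = (\<lambda>p. \<forall>q\<le>p. \<exists>r\<le>q. \<exists>(y, s)\<in>A. r \<le> s \<and> (r \<tturnstile> E x y))"

definition fmem :: "'x \<Rightarrow> ('x, 'p::preorder) name \<Rightarrow> 'p sentence"  (infix "\<^bold>\<in>" 50)
  where "(x \<^bold>\<in> A) = fmem_by (\<lambda>x y. ground (x = y)) x A"

definition fsubset :: "('x, 'p::preorder) name \<Rightarrow> ('x, 'p) name \<Rightarrow> 'p sentence"  (infix "\<^bold>\<subseteq>" 50)
  where "(A \<^bold>\<subseteq> B) = (\<^bold>\<forall>x. x \<^bold>\<in> A \<^bold>\<longrightarrow> x \<^bold>\<in> B)"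

definition feq :: "('x, 'p::preorder) name \<Rightarrow> ('x, 'p) name \<Rightarrow> 'p sentence"  (infix "\<^bold>=" 50)
  where "(A \<^bold>= B) = (\<^bold>\<forall>x. x \<^bold>\<in> A \<^bold>\<longleftrightarrow> x \<^bold>\<in> B)"

definition fMem :: "('x, 'p::preorder) name \<Rightarrow> (('x, 'p) name, 'p) name \<Rightarrow> 'p sentence"
    (infix "\<^bold>\<in>\<^bold>\<in>" 50)
  where "(A \<^bold>\<in>\<^bold>\<in> F) = fmem_by (\<lambda>A B. A \<^bold>= B) A F"

text \<open>
  Canonical names of ground-model sets and of ground-model families of sets. No largest
  condition is assumed, so every element is paired with all conditions.
\<close>

definition check :: "'x set \<Rightarrow> ('x, 'p::preorder) name"
  where "check A = A \<times> UNIV"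

definition Check :: "'x set set \<Rightarrow> (('x, 'p::preorder) name, 'p) name"
  where "Check F = check ` F \<times> UNIV"

definition fcollect :: "'x set \<Rightarrow> ('x \<Rightarrow> 'p::preorder sentence) \<Rightarrow> ('x, 'p) name"
  where \<comment> \<open>the name of \<open>{x \<in> A. \<Phi> x}\<close>, for a ground-model set \<open>A\<close>\<close>
    "fcollect A \<Phi> = {(x, p). x \<in> A \<and> (p \<tturnstile> \<Phi> x)}"

definition generic :: "('p, 'p::preorder) name"
  where \<comment> \<open>the canonical name of the generic filter\<close>
    "generic = {(p, p) | p. True}"


section \<open>Ultrafilters and their names\<close>

definition ultrafilter_on :: "'k set \<Rightarrow> 'k set set \<Rightarrow> bool"
  where "ultrafilter_on K D \<longleftrightarrow>
    D \<subseteq> Pow K \<and> K \<in> D \<and> {} \<notin> D \<and>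
    (\<forall>X Y. X \<in> D \<and> Y \<in> D \<longrightarrow> X \<inter> Y \<in> D) \<and>
    (\<forall>X Y. X \<in> D \<and> X \<subseteq> Y \<and> Y \<subseteq> K \<longrightarrow> Y \<in> D) \<and>
    (\<forall>X. X \<subseteq> K \<longrightarrow> X \<in> D \<or> K - X \<in> D)"

text \<open>The same formula, written in the forcing language and interpreted in the extension.\<close>

definition fultrafilter_on :: "'k set \<Rightarrow> (('k, 'p::preorder) name, 'p) name \<Rightarrow> 'p sentence"
  where "fultrafilter_on K F =
   ((\<^bold>\<forall>X. X \<^bold>\<in>\<^bold>\<in> F \<^bold>\<longrightarrow> X \<^bold>\<subseteq> check K) \<^bold>\<and>
    check K \<^bold>\<in>\<^bold>\<in> F \<^bold>\<and>
    \<^bold>\<not> (check {} \<^bold>\<in>\<^bold>\<in> F) \<^bold>\<and>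
    (\<^bold>\<forall>X. \<^bold>\<forall>Y. X \<^bold>\<in>\<^bold>\<in> F \<^bold>\<and> Y \<^bold>\<in>\<^bold>\<in> F \<^bold>\<longrightarrow> fcollect UNIV (\<lambda>k. k \<^bold>\<in> X \<^bold>\<and> k \<^bold>\<in> Y) \<^bold>\<in>\<^bold>\<in> F) \<^bold>\<and>
    (\<^bold>\<forall>X. \<^bold>\<forall>Y. X \<^bold>\<in>\<^bold>\<in> F \<^bold>\<and> X \<^bold>\<subseteq> Y \<^bold>\<and> Y \<^bold>\<subseteq> check K \<^bold>\<longrightarrow> Y \<^bold>\<in>\<^bold>\<in> F) \<^bold>\<and>
    (\<^bold>\<forall>X. X \<^bold>\<subseteq> check K \<^bold>\<longrightarrow> X \<^bold>\<in>\<^bold>\<in> F \<^bold>\<or> fcollect K (\<lambda>k. \<^bold>\<not> (k \<^bold>\<in> X)) \<^bold>\<in>\<^bold>\<in> F))"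

definition ultrafilter_name_extending ::
    "'k set \<Rightarrow> 'k set set \<Rightarrow> (('k, 'p::preorder) name, 'p) name \<Rightarrow> bool"
  where "ultrafilter_name_extending K D F \<longleftrightarrow>
    (\<forall>p. p \<tturnstile> fultrafilter_on K F \<^bold>\<and> (\<^bold>\<forall>X. X \<^bold>\<in>\<^bold>\<in> Check D \<^bold>\<longrightarrow> X \<^bold>\<in>\<^bold>\<in> F))"


section \<open>Uniform linkedness\<close>

text \<open>
  A pair \<open>(D, \<langle>I\<^sub>k : k \<in> K\<rangle>)\<close> is rendered as the triple \<open>(K, D, I)\<close>; extensionality of \<open>I\<close> makes
  the rendering of a family indexed by \<open>K\<close> unique.
\<close>

type_synonym ('k, 'l) ufam = "'k set \<times> 'k set set \<times> ('k \<Rightarrow> 'l set)"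

definition D_star :: "('k, 'l) ufam set"
  where "D_star = {(K, D, I). K \<noteq> {} \<and> ultrafilter_on K D \<and> I \<in> extensional K \<and>
    (\<forall>k\<in>K. finite (I k) \<and> I k \<noteq> {}) \<and> disjoint_family_on I K}"

abbreviation rat_unit :: "real set"
  where "rat_unit \<equiv> {0<..<1} \<inter> \<rat>"

definition dense_in_poset :: "'p::preorder set \<Rightarrow> bool"
  where "dense_in_poset A \<longleftrightarrow> (\<forall>p. \<exists>q\<in>A. q \<le> p)"

text \<open>
  The sentence ``\<open>|{\<ell> \<in> L. p\<^sub>\<ell> \<in> G}| / |L| \<ge> c\<close>'' for a finite ground-model set \<open>L\<close>. Every subset of
  \<open>L\<close> in the extension is a ground-model set \<open>B\<close>, and the cardinality of \<open>B\<close> is absolute.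
\<close>

definition fratio_ge :: "'l set \<Rightarrow> ('l \<Rightarrow> 'p::preorder) \<Rightarrow> real \<Rightarrow> 'p sentence"
  where "fratio_ge L p c =
    (\<^bold>\<exists>B. fcollect L (\<lambda>l. p l \<^bold>\<in> generic) \<^bold>= check B \<^bold>\<and>
      ground (real (card B) / real (card L) \<ge> c))"

text \<open>
  The cardinal \<open>\<mu>\<close> is a cardinal order in the sense of the library, and its elements are the
  members of \<open>Field \<mu>\<close>. As \<open>lim\<^sup>D\<^sup>,\<^sup>I\<close> is one function for each pair \<open>(\<alpha>, \<epsilon>)\<close>, it takes
  \<open>\<alpha>\<close> and \<open>\<epsilon>\<close> as arguments.
\<close>

definition uniformly_linked_witnessed ::
    "'m rel \<Rightarrow> ('k, 'l) ufam set \<Rightarrow> ('m \<Rightarrow> real \<Rightarrow> 'p::preorder set) \<Rightarrow>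
     (('k, 'l) ufam \<Rightarrow> 'm \<Rightarrow> real \<Rightarrow> ('l \<Rightarrow> 'p) \<Rightarrow> 'p) \<Rightarrow> bool"
  where "uniformly_linked_witnessed \<mu> \<D> Q limf \<longleftrightarrow>
    (\<forall>\<epsilon>\<in>rat_unit. dense_in_poset (\<Union>\<alpha>\<in>Field \<mu>. Q \<alpha> \<epsilon>)) \<and>
    (\<forall>(K, D, I)\<in>\<D>. \<exists>D' :: (('k, 'p) name, 'p) name. ultrafilter_name_extending K D D' \<and>
      (\<forall>\<alpha>\<in>Field \<mu>. \<forall>\<epsilon>\<in>rat_unit. \<forall>p \<in> (\<Union>k\<in>K. I k) \<rightarrow>\<^sub>E Q \<alpha> \<epsilon>.
         limf (K, D, I) \<alpha> \<epsilon> p \<tturnstile> fcollect K (\<lambda>k. fratio_ge (I k) p (1 - \<epsilon>)) \<^bold>\<in>\<^bold>\<in> D'))"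

end

theory Submission
  imports Defs
begin

text \<open>
  For the implication from the combinatorial property to linkedness, let \<open>F\<^sub>0\<close> consist of the pairs
  \<open>(check Y, p)\<close> with \<open>Y \<in> D\<close> and of the names of the sets that the limits are required to put into
  the ultrafilter, paired with the conditions below the limit. The combinatorial property says exactly
  that every condition forces the finite intersection property of the members of \<open>F\<^sub>0\<close> it selects.
  Instead of arguing in the extension, Zorn's lemma is applied in the ground model to sets of pairs
  (name, condition) having this property. A maximal one, \<open>M\<close>, is the required name: maximality
  gives that \<open>p\<close> forces \<open>X \<in> M\<close> if and only if \<open>(X, p) \<in> M\<close>, which reduces the ultrafilter axioms
  to statements about \<open>M\<close> itself.

  For the converse, a condition below all the limits forces \<open>a\<close> and the finitely many sets in question
  into the ultrafilter, so some stronger condition forces an element \<open>k\<close> into their intersection;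
  as \<open>I\<^sub>k\<close> is finite, it can be strengthened to lie below all the \<open>r\<^sup>i\<^sub>\<ell>\<close> forced into the generic filter.
\<close>

section \<open>Regular sentences\<close>

text \<open>
  The connectives unfold to the expected clauses only for sentences that are forced by \<open>p\<close> as soon
  as they are forced densely below \<open>p\<close>, i.e. for regular open sets of conditions.
\<close>

definition regular :: "'p::preorder sentence \<Rightarrow> bool"
  where "regular \<phi> \<longleftrightarrow> (\<forall>p. (p \<tturnstile> \<phi>) \<longleftrightarrow> (\<forall>q\<le>p. \<exists>r\<le>q. r \<tturnstile> \<phi>))"

lemma forces_mono: "regular \<phi> \<Longrightarrow> p \<tturnstile> \<phi> \<Longrightarrow> q \<le> p \<Longrightarrow> q \<tturnstile> \<phi>"
  unfolding regular_def by (meson order_trans)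

lemma forces_denseI: "regular \<phi> \<Longrightarrow> (\<And>q. q \<le> p \<Longrightarrow> \<exists>r\<le>q. r \<tturnstile> \<phi>) \<Longrightarrow> p \<tturnstile> \<phi>"
  unfolding regular_def by blast

lemma regularI:
  assumes "\<And>p q. p \<tturnstile> \<phi> \<Longrightarrow> q \<le> p \<Longrightarrow> q \<tturnstile> \<phi>"
    and "\<And>p. (\<And>q. q \<le> p \<Longrightarrow> \<exists>r\<le>q. r \<tturnstile> \<phi>) \<Longrightarrow> p \<tturnstile> \<phi>"
  shows "regular \<phi>"
  unfolding regular_def using assms by (meson order_refl)

lemma forces_neg: "(p \<tturnstile> \<^bold>\<not> \<phi>) \<longleftrightarrow> (\<forall>q\<le>p. \<not> (q \<tturnstile> \<phi>))"
  by (simp add: fneg_def forces_def)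

lemma forces_conj [simp]: "(p \<tturnstile> \<phi> \<^bold>\<and> \<psi>) \<longleftrightarrow> (p \<tturnstile> \<phi>) \<and> (p \<tturnstile> \<psi>)"
  by (simp add: fconj_def forces_def)

lemma forces_all [simp]: "(p \<tturnstile> fall \<Phi>) \<longleftrightarrow> (\<forall>x. p \<tturnstile> \<Phi> x)"
  by (simp add: fall_def forces_def)

lemma forces_ground [simp]: "(p \<tturnstile> ground b) \<longleftrightarrow> b"
  by (simp add: ground_def forces_def)

lemma regular_ground [simp]: "regular (ground b)"
  unfolding regular_def by auto

lemma regular_neg [simp]: "regular \<phi> \<Longrightarrow> regular (\<^bold>\<not> \<phi>)"
  by (rule regularI) (meson forces_neg forces_mono order_trans order_refl)+

lemma regular_conj [simp]: "regular \<phi> \<Longrightarrow> regular \<psi> \<Longrightarrow> regular (\<phi> \<^bold>\<and> \<psi>)"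
proof (rule regularI)
  assume reg: "regular \<phi>" "regular \<psi>"
  show "q \<tturnstile> \<phi> \<^bold>\<and> \<psi>" if "p \<tturnstile> \<phi> \<^bold>\<and> \<psi>" "q \<le> p" for p q
    using that reg forces_mono by auto
  show "p \<tturnstile> \<phi> \<^bold>\<and> \<psi>" if "\<And>q. q \<le> p \<Longrightarrow> \<exists>r\<le>q. r \<tturnstile> \<phi> \<^bold>\<and> \<psi>" for p
    using that forces_denseI[OF reg(1)] forces_denseI[OF reg(2)] unfolding forces_conj by blast
qed

lemma regular_all [simp]: "(\<And>x. regular (\<Phi> x)) \<Longrightarrow> regular (fall \<Phi>)"
proof (rule regularI)
  assume reg: "\<And>x. regular (\<Phi> x)"
  show "q \<tturnstile> fall \<Phi>" if "p \<tturnstile> fall \<Phi>" "q \<le> p" for p q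
    using that forces_mono[OF reg] by auto
  show "p \<tturnstile> fall \<Phi>" if "\<And>q. q \<le> p \<Longrightarrow> \<exists>r\<le>q. r \<tturnstile> fall \<Phi>" for p
    using that forces_denseI[OF reg] unfolding forces_all by blast
qed

lemma regular_imp [simp]: "regular \<phi> \<Longrightarrow> regular \<psi> \<Longrightarrow> regular (\<phi> \<^bold>\<longrightarrow> \<psi>)"
  by (simp add: fimp_def)

lemma regular_disj [simp]: "regular \<phi> \<Longrightarrow> regular \<psi> \<Longrightarrow> regular (\<phi> \<^bold>\<or> \<psi>)"
  by (simp add: fdisj_def)

lemma regular_iff [simp]: "regular \<phi> \<Longrightarrow> regular \<psi> \<Longrightarrow> regular (\<phi> \<^bold>\<longleftrightarrow> \<psi>)"
  by (simp add: fiff_def)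

lemma regular_ex [simp]: "(\<And>x. regular (\<Phi> x)) \<Longrightarrow> regular (fex \<Phi>)"
  by (simp add: fex_def)

text \<open>The defining clause says only that below \<open>p\<close> every condition forcing
  \<open>\<phi>\<close> has an extension forcing \<open>\<psi>\<close>. Regularity of
  \<open>\<phi>\<close> makes such extensions dense, and regularity of \<open>\<psi>\<close> then
  removes the extension.\<close>

lemma forces_imp:
  assumes "regular \<phi>" "regular \<psi>"
  shows "(p \<tturnstile> \<phi> \<^bold>\<longrightarrow> \<psi>) \<longleftrightarrow> (\<forall>q\<le>p. (q \<tturnstile> \<phi>) \<longrightarrow> (q \<tturnstile> \<psi>))"
proof
  assume "p \<tturnstile> \<phi> \<^bold>\<longrightarrow> \<psi>"
  then have *: "\<exists>r\<le>q. r \<tturnstile> \<psi>" if "q \<le> p" "q \<tturnstile> \<phi>" for q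
    using that by (auto simp: fimp_def forces_neg)
  show "\<forall>q\<le>p. (q \<tturnstile> \<phi>) \<longrightarrow> (q \<tturnstile> \<psi>)"
    using * assms by (meson forces_denseI forces_mono order_trans)
qed (auto simp: fimp_def forces_neg)

lemma forces_iff:
  assumes "regular \<phi>" "regular \<psi>"
  shows "(p \<tturnstile> \<phi> \<^bold>\<longleftrightarrow> \<psi>) \<longleftrightarrow> (\<forall>q\<le>p. (q \<tturnstile> \<phi>) \<longleftrightarrow> (q \<tturnstile> \<psi>))"
  using assms by (auto simp: fiff_def forces_imp)

lemma forces_disj: "(p \<tturnstile> \<phi> \<^bold>\<or> \<psi>) \<longleftrightarrow> (\<forall>q\<le>p. \<exists>r\<le>q. (r \<tturnstile> \<phi>) \<or> (r \<tturnstile> \<psi>))"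
  unfolding fdisj_def forces_neg forces_conj by (meson order_trans order_refl)

lemma forces_ex: "(p \<tturnstile> fex \<Phi>) \<longleftrightarrow> (\<forall>q\<le>p. \<exists>r\<le>q. \<exists>x. r \<tturnstile> \<Phi> x)"
  unfolding fex_def forces_neg forces_all by blast

section \<open>Membership and equality of names\<close>

lemma forces_mem_by:
  "(p \<tturnstile> fmem_by E x A) \<longleftrightarrow> (\<forall>q\<le>p. \<exists>r\<le>q. \<exists>(y, s)\<in>A. r \<le> s \<and> (r \<tturnstile> E x y))"
  by (simp add: fmem_by_def forces_def)

text \<open>Density below the condition is built into the clause for membership, so this holds for
  every \<open>E\<close>.\<close>

lemma regular_mem_by [simp]: "regular (fmem_by E x A)"
proof (rule regularI)
  show "q \<tturnstile> fmem_by E x A" if "p \<tturnstile> fmem_by E x A" "q \<le> p" for p q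
    using that unfolding forces_mem_by by (meson order_trans)
  show "p \<tturnstile> fmem_by E x A" if "\<And>q. q \<le> p \<Longrightarrow> \<exists>r\<le>q. r \<tturnstile> fmem_by E x A" for p
    using that unfolding forces_mem_by by (meson order_trans order_refl)
qed

lemma regular_mem [simp]: "regular (x \<^bold>\<in> A)"
  by (simp add: fmem_def)

lemma regular_Mem [simp]: "regular (X \<^bold>\<in>\<^bold>\<in> F)"
  by (simp add: fMem_def)

lemma regular_subset [simp]: "regular (A \<^bold>\<subseteq> B)"
  by (simp add: fsubset_def)

lemma regular_eq [simp]: "regular (A \<^bold>= B)"
  by (simp add: feq_def)

lemma forces_mem: "(p \<tturnstile> x \<^bold>\<in> A) \<longleftrightarrow> (\<forall>q\<le>p. \<exists>r\<le>q. \<exists>s. (x, s) \<in> A \<and> r \<le> s)"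
  unfolding fmem_def forces_mem_by by fastforce

lemma forces_Mem:
  "(p \<tturnstile> X \<^bold>\<in>\<^bold>\<in> F) \<longleftrightarrow> (\<forall>q\<le>p. \<exists>r\<le>q. \<exists>Y s. (Y, s) \<in> F \<and> r \<le> s \<and> (r \<tturnstile> X \<^bold>= Y))"
  unfolding fMem_def forces_mem_by by fastforce

lemma forces_subset:
  "(p \<tturnstile> A \<^bold>\<subseteq> B) \<longleftrightarrow> (\<forall>x. \<forall>q\<le>p. (q \<tturnstile> x \<^bold>\<in> A) \<longrightarrow> (q \<tturnstile> x \<^bold>\<in> B))"
  by (simp add: fsubset_def forces_imp)

lemma forces_eq:
  "(p \<tturnstile> A \<^bold>= B) \<longleftrightarrow> (\<forall>x. \<forall>q\<le>p. (q \<tturnstile> x \<^bold>\<in> A) \<longleftrightarrow> (q \<tturnstile> x \<^bold>\<in> B))"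
  by (simp add: feq_def forces_iff)

lemma forces_Mem_cong: "p \<tturnstile> X \<^bold>\<in>\<^bold>\<in> F \<Longrightarrow> p \<tturnstile> X \<^bold>= Y \<Longrightarrow> p \<tturnstile> Y \<^bold>\<in>\<^bold>\<in> F"
  unfolding forces_Mem forces_eq by (meson order_trans)

lemma forces_MemI: "(X, s) \<in> F \<Longrightarrow> p \<le> s \<Longrightarrow> p \<tturnstile> X \<^bold>\<in>\<^bold>\<in> F"
  unfolding forces_Mem forces_eq by (meson order_trans order_refl)

lemma forces_mem_check [simp]: "(p \<tturnstile> x \<^bold>\<in> check A) \<longleftrightarrow> x \<in> A"
  unfolding forces_mem check_def by auto

lemma forces_Mem_Check:
  "(p \<tturnstile> X \<^bold>\<in>\<^bold>\<in> Check D) \<longleftrightarrow> (\<forall>q\<le>p. \<exists>r\<le>q. \<exists>Y\<in>D. r \<tturnstile> X \<^bold>= check Y)"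
  unfolding forces_Mem Check_def by fastforce

text \<open>Unfolding membership gives densely many conditions that force \<open>\<Phi> x\<close>;
  regularity turns this back into \<open>p\<close> forcing it.\<close>

lemma forces_mem_collect:
  assumes "\<And>x. regular (\<Phi> x)"
  shows "(p \<tturnstile> x \<^bold>\<in> fcollect A \<Phi>) \<longleftrightarrow> x \<in> A \<and> (p \<tturnstile> \<Phi> x)"
proof
  assume *: "p \<tturnstile> x \<^bold>\<in> fcollect A \<Phi>"
  have "\<exists>r\<le>q. x \<in> A \<and> (r \<tturnstile> \<Phi> x)" if "q \<le> p" for q
    using * that forces_mono[OF assms] unfolding forces_mem fcollect_def by blast
  then show "x \<in> A \<and> (p \<tturnstile> \<Phi> x)"
    using forces_denseI[OF assms] by (meson order_refl)
next
  assume "x \<in> A \<and> (p \<tturnstile> \<Phi> x)"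
  then show "p \<tturnstile> x \<^bold>\<in> fcollect A \<Phi>"
    unfolding forces_mem fcollect_def by auto
qed

text \<open>In general weaker than \<open>p \<le> x\<close>, as the order is not assumed separative.
  To lie below \<open>x\<close> itself, a condition has to be strengthened.\<close>

lemma forces_generic: "(p \<tturnstile> x \<^bold>\<in> generic) \<longleftrightarrow> (\<forall>q\<le>p. \<exists>r\<le>q. r \<le> x)"
  unfolding forces_mem generic_def by simp

text \<open>Reduces the forced axioms to statements about the conditions below \<open>p\<close>. The
  disjunction stays in the forcing language, since it can only be decided densely.\<close>

lemma forces_ultrafilter_on:
  "(p \<tturnstile> fultrafilter_on K F) \<longleftrightarrow>
    (\<forall>X. \<forall>q\<le>p. (q \<tturnstile> X \<^bold>\<in>\<^bold>\<in> F) \<longrightarrow> (q \<tturnstile> X \<^bold>\<subseteq> check K)) \<and>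
    (p \<tturnstile> check K \<^bold>\<in>\<^bold>\<in> F) \<and>
    (\<forall>q\<le>p. \<not> (q \<tturnstile> check {} \<^bold>\<in>\<^bold>\<in> F)) \<and>
    (\<forall>X Y. \<forall>q\<le>p. (q \<tturnstile> X \<^bold>\<in>\<^bold>\<in> F) \<and> (q \<tturnstile> Y \<^bold>\<in>\<^bold>\<in> F) \<longrightarrow>
      (q \<tturnstile> fcollect UNIV (\<lambda>k. k \<^bold>\<in> X \<^bold>\<and> k \<^bold>\<in> Y) \<^bold>\<in>\<^bold>\<in> F)) \<and>
    (\<forall>X Y. \<forall>q\<le>p. (q \<tturnstile> X \<^bold>\<in>\<^bold>\<in> F) \<and> (q \<tturnstile> X \<^bold>\<subseteq> Y) \<and> (q \<tturnstile> Y \<^bold>\<subseteq> check K) \<longrightarrow> (q \<tturnstile> Y \<^bold>\<in>\<^bold>\<in> F)) \<and>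
    (\<forall>X. \<forall>q\<le>p. (q \<tturnstile> X \<^bold>\<subseteq> check K) \<longrightarrow>
      (q \<tturnstile> X \<^bold>\<in>\<^bold>\<in> F \<^bold>\<or> fcollect K (\<lambda>k. \<^bold>\<not> (k \<^bold>\<in> X)) \<^bold>\<in>\<^bold>\<in> F))"
  by (simp add: fultrafilter_on_def forces_imp forces_neg)

section \<open>Relative cardinalities\<close>

lemma regular_ratio_ge [simp]: "regular (fratio_ge L p c)"
  by (simp add: fratio_ge_def)

text \<open>Each sentence is decided by some extension, and decisions persist to stronger
  conditions, so finitely many can be decided one after the other.\<close>

lemma exists_decider:
  assumes "finite L" "\<And>l. regular (\<Phi> l)"
  shows "\<exists>r\<le>q. \<forall>l\<in>L. (r \<tturnstile> \<Phi> l) \<or> (r \<tturnstile> \<^bold>\<not> \<Phi> l)"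
  using assms(1)
proof induction
  case empty
  show ?case by auto
next
  case (insert l L)
  then obtain r where r: "r \<le> q" "\<forall>l\<in>L. (r \<tturnstile> \<Phi> l) \<or> (r \<tturnstile> \<^bold>\<not> \<Phi> l)"
    by blast
  obtain s where s: "s \<le> r" "(s \<tturnstile> \<Phi> l) \<or> (s \<tturnstile> \<^bold>\<not> \<Phi> l)"
    by (meson forces_neg order_refl)
  have "(s \<tturnstile> \<Phi> l') \<or> (s \<tturnstile> \<^bold>\<not> \<Phi> l')" if "l' \<in> L" for l'
    using r(2) that s(1) assms(2) by (meson forces_mono regular_neg)
  then show ?case
    using s r(1) order_trans by blast
qed

text \<open>By \<open>forces_generic\<close>, each step can go below one more \<open>p l\<close>;
  finiteness lets this end in a single condition.\<close>

lemma exists_below_generic_members: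
  assumes "finite B" "\<And>l. l \<in> B \<Longrightarrow> q \<tturnstile> p l \<^bold>\<in> generic"
  shows "\<exists>r\<le>q. \<forall>l\<in>B. r \<le> p l"
  using assms
proof (induction rule: finite_induct)
  case empty
  show ?case by auto
next
  case (insert l B)
  then obtain r where r: "r \<le> q" "\<forall>l\<in>B. r \<le> p l"
    by blast
  obtain s where s: "s \<le> r" "s \<le> p l"
    using insert.prems[of l] r(1) by (auto simp: forces_generic)
  have "s \<le> q"
    using s(1) r(1) by (rule order_trans)
  moreover have "s \<le> p l'" if "l' \<in> insert l B" for l'
    using that s r(2) order_trans[OF s(1)] by blast
  ultimately show ?case by blast
qed

lemma ratio_mono:
  assumes "finite L" "A \<subseteq> B" "B \<subseteq> L" "real (card A) / real (card L) \<ge> c"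
  shows "real (card B) / real (card L) \<ge> c"
proof -
  have "card A \<le> card B"
    using assms by (meson card_mono finite_subset)
  then show ?thesis
    using assms(4) by (meson divide_right_mono of_nat_0_le_iff of_nat_mono order_trans)
qed

text \<open>An extension decides the set \<open>B\<close> of those \<open>l\<close> with
  \<open>p l\<close> in the generic filter. A further one lies below \<open>p l\<close> for all
  \<open>l\<close> in \<open>B\<close>, so the indices counted in the conclusion include
  \<open>B\<close>.\<close>

lemma forces_ratio_geD:
  assumes "finite L" "q \<tturnstile> fratio_ge L p c"
  shows "\<exists>r\<le>q. real (card {l \<in> L. r \<le> p l}) / real (card L) \<ge> c"
proof -
  obtain r B where r: "r \<le> q" "r \<tturnstile> fcollect L (\<lambda>l. p l \<^bold>\<in> generic) \<^bold>= check B"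
    and c: "real (card B) / real (card L) \<ge> c"
    using assms(2) unfolding fratio_ge_def forces_ex by auto
  have B: "l \<in> L \<and> (r \<tturnstile> p l \<^bold>\<in> generic)" if "l \<in> B" for l
    using r(2) that by (auto simp: forces_eq forces_mem_collect)
  then obtain s where "s \<le> r" "\<forall>l\<in>B. s \<le> p l"
    using exists_below_generic_members[of B r p] assms(1) by (meson finite_subset subsetI)
  then show ?thesis
    using ratio_mono[OF assms(1) _ _ c, of "{l \<in> L. s \<le> p l}"] B r(1) order_trans by blast
qed

text \<open>A condition below \<open>p l\<close> forces \<open>p l\<close> into the generic filter,
  so the set decided by any suitable extension contains the indices counted for
  \<open>q\<close>.\<close>

lemma forces_ratio_geI:
  assumes "finite L" "real (card {l \<in> L. q \<le> p l}) / real (card L) \<ge> c"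
  shows "q \<tturnstile> fratio_ge L p c"
  unfolding fratio_ge_def forces_ex
proof (intro allI impI)
  fix q' assume q': "q' \<le> q"
  obtain r where r: "r \<le> q'" and
    dec: "\<forall>l\<in>L. (r \<tturnstile> p l \<^bold>\<in> generic) \<or> (r \<tturnstile> \<^bold>\<not> (p l \<^bold>\<in> generic))"
    using exists_decider[of L "\<lambda>l. p l \<^bold>\<in> generic" q'] assms(1) by auto
  define B where "B = {l \<in> L. r \<tturnstile> p l \<^bold>\<in> generic}"
  \<comment> \<open>An extension of \<open>r\<close> forcing \<open>p l\<close> into the generic
    filter excludes the negative decision on \<open>l\<close>, hence \<open>l\<close> is in
    \<open>B\<close> already.\<close>
  have "r \<tturnstile> fcollect L (\<lambda>l. p l \<^bold>\<in> generic) \<^bold>= check B"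
    using dec by (auto simp: forces_eq forces_mem_collect B_def forces_neg intro: forces_mono)
  moreover have "r \<tturnstile> p l \<^bold>\<in> generic" if "q \<le> p l" for l
    using that r q' unfolding forces_generic by (meson order_refl order_trans)
  then have "{l \<in> L. q \<le> p l} \<subseteq> B"
    unfolding B_def by blast
  then have "real (card B) / real (card L) \<ge> c"
    using assms by (auto simp: B_def intro: ratio_mono)
  ultimately show "\<exists>r\<le>q'. \<exists>B. r \<tturnstile> fcollect L (\<lambda>l. p l \<^bold>\<in> generic) \<^bold>= check B \<^bold>\<and>
      ground (real (card B) / real (card L) \<ge> c)"
    using r by auto
qed

text \<open>The sequences are treated one at a time: strengthening the condition only enlarges the
  sets counted for earlier ones, so their bounds survive.\<close>

lemma exists_common_ratio_ge:
  fixes n :: nat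
  assumes "finite L" "\<And>i. i < n \<Longrightarrow> q \<tturnstile> fratio_ge L (p i) (c i)"
  shows "\<exists>r\<le>q. \<forall>i<n. real (card {l \<in> L. r \<le> p i l}) / real (card L) \<ge> c i"
  using assms(2)
proof (induction n)
  case 0
  show ?case by auto
next
  case (Suc n)
  then obtain r where r: "r \<le> q" and
    IH: "\<forall>i<n. real (card {l \<in> L. r \<le> p i l}) / real (card L) \<ge> c i"
    by auto
  have "r \<tturnstile> fratio_ge L (p n) (c n)"
    using Suc.prems[of n] r by (auto intro: forces_mono)
  then obtain s where s: "s \<le> r" "real (card {l \<in> L. s \<le> p n l}) / real (card L) \<ge> c n"
    using forces_ratio_geD[OF assms(1)] by blast
  have "real (card {l \<in> L. s \<le> p i l}) / real (card L) \<ge> c i" if "i < n" for i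
    by (rule ratio_mono[OF assms(1), of "{l \<in> L. r \<le> p i l}"])
      (use IH that s(1) in \<open>auto intro: order_trans\<close>)
  then have "\<forall>i<Suc n. real (card {l \<in> L. s \<le> p i l}) / real (card L) \<ge> c i"
    using s(2) by (auto simp: less_Suc_eq)
  then show ?case
    using order_trans[OF s(1) r] by blast
qed

section \<open>From names of ultrafilters to the combinatorial property\<close>

lemma ultrafilter_name_finite_Int:
  fixes n :: nat
  assumes F: "q \<tturnstile> fultrafilter_on K F" and A: "q \<tturnstile> A \<^bold>\<in>\<^bold>\<in> F" and B: "\<And>i. i < n \<Longrightarrow> q \<tturnstile> B i \<^bold>\<in>\<^bold>\<in> F"
  shows "\<exists>q'\<le>q. \<exists>k. (q' \<tturnstile> k \<^bold>\<in> A) \<and> (\<forall>i<n. q' \<tturnstile> k \<^bold>\<in> B i)"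
proof -
  \<comment> \<open>\<open>Z\<close> names the intersection of \<open>A\<close> and the first
    \<open>n\<close> sets. Only its inclusion in each of them is recorded, as this suffices to
    transfer a member.\<close>
  have "\<exists>Z. (q \<tturnstile> Z \<^bold>\<in>\<^bold>\<in> F) \<and>
      (\<forall>q'\<le>q. \<forall>k. (q' \<tturnstile> k \<^bold>\<in> Z) \<longrightarrow> (q' \<tturnstile> k \<^bold>\<in> A) \<and> (\<forall>i<n. q' \<tturnstile> k \<^bold>\<in> B i))"
    using B
  proof (induction n)
    case 0
    show ?case using A by auto
  next
    case (Suc n)
    then obtain Z where Z: "q \<tturnstile> Z \<^bold>\<in>\<^bold>\<in> F"
      "\<forall>q'\<le>q. \<forall>k. (q' \<tturnstile> k \<^bold>\<in> Z) \<longrightarrow> (q' \<tturnstile> k \<^bold>\<in> A) \<and> (\<forall>i<n. q' \<tturnstile> k \<^bold>\<in> B i)"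
      by auto
    have "q \<tturnstile> fcollect UNIV (\<lambda>k. k \<^bold>\<in> Z \<^bold>\<and> k \<^bold>\<in> B n) \<^bold>\<in>\<^bold>\<in> F"
      using F Z(1) Suc.prems[of n] unfolding forces_ultrafilter_on by (meson lessI order_refl)
    moreover have "(q' \<tturnstile> k \<^bold>\<in> A) \<and> (\<forall>i<Suc n. q' \<tturnstile> k \<^bold>\<in> B i)"
      if "q' \<le> q" "q' \<tturnstile> k \<^bold>\<in> fcollect UNIV (\<lambda>k. k \<^bold>\<in> Z \<^bold>\<and> k \<^bold>\<in> B n)" for q' k
      using that Z(2) by (auto simp: forces_mem_collect less_Suc_eq)
    ultimately show ?case by blast
  qed
  then obtain Z where Z: "q \<tturnstile> Z \<^bold>\<in>\<^bold>\<in> F"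
    "\<forall>q'\<le>q. \<forall>k. (q' \<tturnstile> k \<^bold>\<in> Z) \<longrightarrow> (q' \<tturnstile> k \<^bold>\<in> A) \<and> (\<forall>i<n. q' \<tturnstile> k \<^bold>\<in> B i)"
    by blast
  have "\<not> (q \<tturnstile> check {} \<^bold>\<in>\<^bold>\<in> F)"
    using F unfolding forces_ultrafilter_on by (meson order_refl)
  \<comment> \<open>Nothing is ever forced into \<open>check {}\<close>, so failure of this equality
    yields an extension forcing some \<open>k\<close> into \<open>Z\<close>.\<close>
  then have "\<not> (q \<tturnstile> Z \<^bold>= check {})"
    using forces_Mem_cong[OF Z(1)] by blast
  then obtain q' k where "q' \<le> q" "q' \<tturnstile> k \<^bold>\<in> Z"
    by (auto simp: forces_eq)
  then show ?thesis
    using Z(2) by blast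
qed

section \<open>Extending centred names to ultrafilter names\<close>

text \<open>The pairs \<open>(X, s)\<close> with \<open>p \<le> s\<close> are those whose
  \<open>X\<close> is put into the family by \<open>p\<close> directly. The second clause is the
  finite intersection property of these sets, stated without leaving the ground model:
  \<open>S\<close> is a ground-model set and \<open>q\<close> decides a common element
  \<open>k\<close>.\<close>

definition centred_name :: "'k set \<Rightarrow> (('k, 'p::preorder) name, 'p) name \<Rightarrow> bool"
  where "centred_name K F \<longleftrightarrow>
    (\<forall>(X, s)\<in>F. s \<tturnstile> X \<^bold>\<subseteq> check K) \<and>
    (\<forall>S p. finite S \<and> S \<subseteq> F \<and> (\<forall>(X, s)\<in>S. p \<le> s) \<longrightarrow>
      (\<exists>q\<le>p. \<exists>k\<in>K. \<forall>(X, s)\<in>S. q \<tturnstile> k \<^bold>\<in> X))"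

definition maximal_centred_name :: "'k set \<Rightarrow> (('k, 'p::preorder) name, 'p) name \<Rightarrow> bool"
  where "maximal_centred_name K M \<longleftrightarrow>
    centred_name K M \<and> (\<forall>F. centred_name K F \<and> M \<subseteq> F \<longrightarrow> F = M)"

text \<open>Zorn's lemma applies because centredness has finite character: a finite subset of the
  union of a non-empty chain lies in one member of the chain.\<close>

lemma exists_maximal_centred_name:
  assumes "centred_name K F\<^sub>0"
  shows "\<exists>M. F\<^sub>0 \<subseteq> M \<and> maximal_centred_name K M"
proof -
  let ?\<F> = "{F. centred_name K F \<and> F\<^sub>0 \<subseteq> F}"
  have "\<exists>U\<in>?\<F>. \<forall>X\<in>C. X \<subseteq> U" if C: "subset.chain ?\<F> C" for C
  proof (cases "C = {}")
    case True
    then show ?thesis using assms by auto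
  next
    case False
    have CF: "centred_name K F" "F\<^sub>0 \<subseteq> F" if "F \<in> C" for F
      using C that by (auto simp: subset_chain_def)
    have "centred_name K (\<Union>C)"
      unfolding centred_name_def
    proof (intro conjI allI impI)
      show "\<forall>(X, s)\<in>\<Union>C. s \<tturnstile> X \<^bold>\<subseteq> check K"
        using CF unfolding centred_name_def by blast
    next
      fix S p assume S: "finite S \<and> S \<subseteq> \<Union>C \<and> (\<forall>(X, s)\<in>S. p \<le> s)"
      then obtain F where "F \<in> C" "S \<subseteq> F"
        using finite_subset_Union_chain[of S C ?\<F>] False C by blast
      with CF S show "\<exists>q\<le>p. \<exists>k\<in>K. \<forall>(X, s)\<in>S. q \<tturnstile> k \<^bold>\<in> X"
        unfolding centred_name_def by blast
    qed
    then show ?thesis using CF False by blast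
  qed
  from subset_Zorn[OF this] obtain M where M: "M \<in> ?\<F>" "\<forall>X\<in>?\<F>. M \<subseteq> X \<longrightarrow> X = M"
    by blast
  then have "F = M" if "centred_name K F" "M \<subseteq> F" for F
    using that by auto
  with M(1) show ?thesis
    unfolding maximal_centred_name_def by auto
qed

section \<open>Closure properties of a maximal centred name\<close>

context
  fixes K :: "'k set" and M :: "(('k, 'p::preorder) name, 'p) name"
  assumes M: "maximal_centred_name K M"
begin

lemma maximal_subset: "(X, s) \<in> M \<Longrightarrow> s \<tturnstile> X \<^bold>\<subseteq> check K"
  using M unfolding maximal_centred_name_def centred_name_def by blast

lemma maximal_centred:
  assumes "finite S" "S \<subseteq> M" "\<And>X s. (X, s) \<in> S \<Longrightarrow> p \<le> s"
  shows "\<exists>q\<le>p. \<exists>k\<in>K. \<forall>(X, s)\<in>S. q \<tturnstile> k \<^bold>\<in> X"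
proof -
  have "finite S \<and> S \<subseteq> M \<and> (\<forall>(X, s)\<in>S. p \<le> s)"
    using assms by auto
  then show ?thesis
    using M unfolding maximal_centred_name_def centred_name_def by blast
qed

text \<open>Under these hypotheses adding \<open>(X, p)\<close> keeps \<open>M\<close> centred, so
  maximality puts the pair into \<open>M\<close>. Read contrapositively, a pair outside
  \<open>M\<close> has a finite obstruction.\<close>

lemma maximalI:
  assumes sub: "p \<tturnstile> X \<^bold>\<subseteq> check K"
    and ex: "\<And>S p'. finite S \<Longrightarrow> S \<subseteq> M \<Longrightarrow> p' \<le> p \<Longrightarrow> (\<And>Y s. (Y, s) \<in> S \<Longrightarrow> p' \<le> s) \<Longrightarrow>
      \<exists>q\<le>p'. \<exists>k. (q \<tturnstile> k \<^bold>\<in> X) \<and> (\<forall>(Y, s)\<in>S. q \<tturnstile> k \<^bold>\<in> Y)"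
  shows "(X, p) \<in> M"
proof -
  have "centred_name K (insert (X, p) M)"
    unfolding centred_name_def
  proof (intro conjI allI impI)
    show "\<forall>(Y, s)\<in>insert (X, p) M. s \<tturnstile> Y \<^bold>\<subseteq> check K"
      using sub maximal_subset by blast
  next
    fix S p' assume S: "finite S \<and> S \<subseteq> insert (X, p) M \<and> (\<forall>(Y, s)\<in>S. p' \<le> s)"
    show "\<exists>q\<le>p'. \<exists>k\<in>K. \<forall>(Y, s)\<in>S. q \<tturnstile> k \<^bold>\<in> Y"
    proof (cases "(X, p) \<in> S")
      case True
      then have p': "p' \<le> p" using S by blast
      have "\<exists>q\<le>p'. \<exists>k. (q \<tturnstile> k \<^bold>\<in> X) \<and> (\<forall>(Y, s)\<in>S - {(X, p)}. q \<tturnstile> k \<^bold>\<in> Y)"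
        by (rule ex) (use S p' in auto)
      then obtain q k where q: "q \<le> p'" "q \<tturnstile> k \<^bold>\<in> X" "\<forall>(Y, s)\<in>S - {(X, p)}. q \<tturnstile> k \<^bold>\<in> Y"
        by blast
      \<comment> \<open>\<open>ex\<close> says nothing about \<open>K\<close>; that \<open>k\<close>
        lies in it comes from \<open>sub\<close>.\<close>
      have "k \<in> K"
        using sub q(1,2) p' unfolding forces_subset forces_mem_check by (meson order_trans)
      then show ?thesis
        using q by blast
    next
      case False
      then show ?thesis
        by (intro maximal_centred) (use S in auto)
    qed
  qed
  then show ?thesis
    using M unfolding maximal_centred_name_def by blast
qed

text \<open>Upward closure: \<open>X\<close> is forced to contain the intersection of finitely many
  sets selected by \<open>p\<close>. A common element of these together with any further selected
  sets is then an element of \<open>X\<close>, as \<open>maximalI\<close> demands.\<close>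

lemma maximal_supersetI:
  assumes S: "finite S" "S \<subseteq> M" "\<And>Y s. (Y, s) \<in> S \<Longrightarrow> p \<le> s"
    and sub: "p \<tturnstile> X \<^bold>\<subseteq> check K"
    and imp: "\<And>q k. q \<le> p \<Longrightarrow> (\<And>Y s. (Y, s) \<in> S \<Longrightarrow> q \<tturnstile> k \<^bold>\<in> Y) \<Longrightarrow> q \<tturnstile> k \<^bold>\<in> X"
  shows "(X, p) \<in> M"
proof (rule maximalI[OF sub])
  fix S' p' assume S': "finite S'" "S' \<subseteq> M" "p' \<le> p" "\<And>Y s. (Y, s) \<in> S' \<Longrightarrow> p' \<le> s"
  have "\<exists>q\<le>p'. \<exists>k\<in>K. \<forall>(Y, s)\<in>S \<union> S'. q \<tturnstile> k \<^bold>\<in> Y"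
    by (rule maximal_centred) (use S S' in \<open>auto intro: order_trans\<close>)
  then obtain q k where q: "q \<le> p'" "\<And>Y s. (Y, s) \<in> S \<union> S' \<Longrightarrow> q \<tturnstile> k \<^bold>\<in> Y"
    by blast
  then have "q \<tturnstile> k \<^bold>\<in> X"
    using imp[of q k] S'(3) order_trans by blast
  then show "\<exists>q\<le>p'. \<exists>k. (q \<tturnstile> k \<^bold>\<in> X) \<and> (\<forall>(Y, s)\<in>S'. q \<tturnstile> k \<^bold>\<in> Y)"
    using q by blast
qed

text \<open>Forced membership in a name allows passing to extensions and to equal names.
  \<open>M\<close> is closed under both: equal names enter by \<open>maximal_supersetI\<close>, and
  pairs present densely below \<open>p\<close> are present at \<open>p\<close> by
  \<open>maximalI\<close>.\<close>

lemma forces_Mem_maximal: "(p \<tturnstile> X \<^bold>\<in>\<^bold>\<in> M) \<longleftrightarrow> (X, p) \<in> M"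
proof
  assume *: "p \<tturnstile> X \<^bold>\<in>\<^bold>\<in> M"
  have dense: "\<exists>r\<le>q. (X, r) \<in> M" if q: "q \<le> p" for q
  proof -
    obtain r Y s where r: "r \<le> q" "(Y, s) \<in> M" "r \<le> s" "r \<tturnstile> X \<^bold>= Y"
      using * q unfolding forces_Mem by blast
    have "(X, r) \<in> M"
    proof (rule maximal_supersetI[of "{(Y, s)}"])
      show "r \<tturnstile> X \<^bold>\<subseteq> check K"
        using maximal_subset[OF r(2)] r(3,4) unfolding forces_subset forces_eq
        by (meson order_trans)
      show "q' \<tturnstile> k \<^bold>\<in> X" if "q' \<le> r" "\<And>Z t. (Z, t) \<in> {(Y, s)} \<Longrightarrow> q' \<tturnstile> k \<^bold>\<in> Z" for q' k
        using that r(4) unfolding forces_eq by blast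
    qed (use r in auto)
    then show ?thesis using r(1) by blast
  qed
  show "(X, p) \<in> M"
  proof (rule maximalI)
    show "p \<tturnstile> X \<^bold>\<subseteq> check K"
      using dense maximal_subset by (intro forces_denseI[OF regular_subset]) blast
  next
    fix S p' assume S: "finite S" "S \<subseteq> M" "p' \<le> p" "\<And>Y s. (Y, s) \<in> S \<Longrightarrow> p' \<le> s"
    \<comment> \<open>Moving from \<open>p'\<close> to \<open>r\<close> makes the pair
      \<open>(X, r)\<close> selected, so centredness applies to \<open>S\<close> together with
      it.\<close>
    obtain r where r: "r \<le> p'" "(X, r) \<in> M"
      using dense S(3) by blast
    have "\<exists>q\<le>r. \<exists>k\<in>K. \<forall>(Y, s)\<in>insert (X, r) S. q \<tturnstile> k \<^bold>\<in> Y"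
      by (rule maximal_centred) (use S r in \<open>auto intro: order_trans\<close>)
    then show "\<exists>q\<le>p'. \<exists>k. (q \<tturnstile> k \<^bold>\<in> X) \<and> (\<forall>(Y, s)\<in>S. q \<tturnstile> k \<^bold>\<in> Y)"
      using order_trans[OF _ r(1)] by blast
  qed
qed (auto intro: forces_MemI)

text \<open>If \<open>(X, q)\<close> is not in \<open>M\<close>, some finite \<open>S\<close> and
  some \<open>r \<le> q\<close> block it: no extension of \<open>r\<close> forces a \<open>k\<close>
  into \<open>X\<close> and into all sets of \<open>S\<close>. Below \<open>r\<close>, a common
  element of the sets of \<open>S\<close> is therefore forced out of \<open>X\<close>, which makes
  the complement compatible with everything in \<open>M\<close>.\<close>

lemma maximal_decides:
  assumes X: "p \<tturnstile> X \<^bold>\<subseteq> check K" and "q \<le> p"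
  shows "\<exists>r\<le>q. (X, r) \<in> M \<or> (fcollect K (\<lambda>k. \<^bold>\<not> (k \<^bold>\<in> X)), r) \<in> M"
proof (cases "(X, q) \<in> M")
  case True
  then show ?thesis by auto
next
  case False
  have "q \<tturnstile> X \<^bold>\<subseteq> check K"
    using X \<open>q \<le> p\<close> forces_mono regular_subset by blast
  with False obtain S r where S: "finite S" "S \<subseteq> M" "r \<le> q" "\<And>Y s. (Y, s) \<in> S \<Longrightarrow> r \<le> s"
    and no: "\<not> (\<exists>q'\<le>r. \<exists>k. (q' \<tturnstile> k \<^bold>\<in> X) \<and> (\<forall>(Y, s)\<in>S. q' \<tturnstile> k \<^bold>\<in> Y))"
    using maximalI[of q X] by blast
  have "(fcollect K (\<lambda>k. \<^bold>\<not> (k \<^bold>\<in> X)), r) \<in> M"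
  proof (rule maximalI)
    show "r \<tturnstile> fcollect K (\<lambda>k. \<^bold>\<not> (k \<^bold>\<in> X)) \<^bold>\<subseteq> check K"
      by (simp add: forces_subset forces_mem_collect)
  next
    fix S' p' assume S': "finite S'" "S' \<subseteq> M" "p' \<le> r" "\<And>Y s. (Y, s) \<in> S' \<Longrightarrow> p' \<le> s"
    have "\<exists>q\<le>p'. \<exists>k\<in>K. \<forall>(Y, s)\<in>S \<union> S'. q \<tturnstile> k \<^bold>\<in> Y"
      by (rule maximal_centred) (use S S' in \<open>auto intro: order_trans\<close>)
    then obtain q' k where q': "q' \<le> p'" "k \<in> K" "\<And>Y s. (Y, s) \<in> S \<union> S' \<Longrightarrow> q' \<tturnstile> k \<^bold>\<in> Y"
      by blast
    have "\<not> (t \<tturnstile> k \<^bold>\<in> X)" if "t \<le> q'" for t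
    proof -
      have "t \<tturnstile> k \<^bold>\<in> Y" if "(Y, s) \<in> S" for Y s
        using forces_mono[OF regular_mem q'(3) \<open>t \<le> q'\<close>] that by blast
      moreover have "t \<le> r"
        using \<open>t \<le> q'\<close> q'(1) S'(3) by (blast intro: order_trans)
      ultimately show ?thesis
        using no by blast
    qed
    then have "q' \<tturnstile> k \<^bold>\<in> fcollect K (\<lambda>k. \<^bold>\<not> (k \<^bold>\<in> X))"
      using q'(2) by (simp add: forces_mem_collect forces_neg)
    then show "\<exists>q\<le>p'. \<exists>k. (q \<tturnstile> k \<^bold>\<in> fcollect K (\<lambda>k. \<^bold>\<not> (k \<^bold>\<in> X))) \<and> (\<forall>(Y, s)\<in>S'. q \<tturnstile> k \<^bold>\<in> Y)"
      using q' by blast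
  qed
  then show ?thesis using S(3) by blast
qed

text \<open>After rewriting with \<open>forces_Mem_maximal\<close> only closure properties of
  \<open>M\<close> remain: intersections and supersets come from \<open>maximal_supersetI\<close>,
  properness from centredness, and the dichotomy from \<open>maximal_decides\<close>.\<close>

lemma maximal_ultrafilter:
  assumes "(check K, p) \<in> M"
  shows "p \<tturnstile> fultrafilter_on K M"
  unfolding forces_ultrafilter_on forces_disj forces_Mem_maximal
proof (intro conjI allI impI)
  show "(check K, p) \<in> M"
    by fact
  show "q \<tturnstile> X \<^bold>\<subseteq> check K" if "(X, q) \<in> M" for X q
    using maximal_subset that .
  show "(check {}, q) \<notin> M" for q
    using maximal_centred[of "{(check {}, q)}" q] by auto
  show "(fcollect UNIV (\<lambda>k. k \<^bold>\<in> X \<^bold>\<and> k \<^bold>\<in> Y), q) \<in> M" if "(X, q) \<in> M \<and> (Y, q) \<in> M" for X Y q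
  proof (rule maximal_supersetI[of "{(X, q), (Y, q)}"])
    show "q \<tturnstile> fcollect UNIV (\<lambda>k. k \<^bold>\<in> X \<^bold>\<and> k \<^bold>\<in> Y) \<^bold>\<subseteq> check K"
      using maximal_subset[of X q] that by (auto simp: forces_subset forces_mem_collect)
  qed (use that in \<open>auto simp: forces_mem_collect\<close>)
  show "(Y, q) \<in> M" if "(X, q) \<in> M \<and> (q \<tturnstile> X \<^bold>\<subseteq> Y) \<and> (q \<tturnstile> Y \<^bold>\<subseteq> check K)" for X Y q
    by (rule maximal_supersetI[of "{(X, q)}"]) (use that in \<open>auto simp: forces_subset\<close>)
  show "\<exists>r\<le>q'. (X, r) \<in> M \<or> (fcollect K (\<lambda>k. \<^bold>\<not> (k \<^bold>\<in> X)), r) \<in> M"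
    if "q \<tturnstile> X \<^bold>\<subseteq> check K" "q' \<le> q" for X q q'
    using maximal_decides that .
qed

end

text \<open>As \<open>check Y\<close> is paired with every condition for \<open>Y\<close> in
  \<open>D\<close>, all conditions force it into the maximal name. A name forced into
  \<open>Check D\<close> is densely equal to such a \<open>check Y\<close>.\<close>

lemma centred_name_extends:
  assumes F\<^sub>0: "centred_name K F\<^sub>0" and "K \<in> D"
    and D: "\<And>Y p. Y \<in> D \<Longrightarrow> (check Y, p) \<in> F\<^sub>0"
  shows "\<exists>M. F\<^sub>0 \<subseteq> M \<and> ultrafilter_name_extending K D M"
proof -
  obtain M where "F\<^sub>0 \<subseteq> M" and M: "maximal_centred_name K M"
    using exists_maximal_centred_name[OF F\<^sub>0] by blast
  have "(p \<tturnstile> X \<^bold>\<in>\<^bold>\<in> M)" if X: "p \<tturnstile> X \<^bold>\<in>\<^bold>\<in> Check D" for p X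
  proof (rule forces_denseI[OF regular_Mem])
    fix q assume "q \<le> p"
    then obtain r Y where "r \<le> q" "Y \<in> D" "r \<tturnstile> X \<^bold>= check Y"
      using X unfolding forces_Mem_Check by blast
    moreover from this have "r \<tturnstile> check Y \<^bold>\<in>\<^bold>\<in> M"
      using D \<open>F\<^sub>0 \<subseteq> M\<close> by (auto intro: forces_MemI)
    ultimately show "\<exists>r\<le>q. r \<tturnstile> X \<^bold>\<in>\<^bold>\<in> M"
      using forces_Mem_cong by (metis forces_eq)
  qed
  moreover have "p \<tturnstile> fultrafilter_on K M" for p
    by (rule maximal_ultrafilter[OF M]) (use D \<open>K \<in> D\<close> \<open>F\<^sub>0 \<subseteq> M\<close> in blast)
  ultimately have "ultrafilter_name_extending K D M"
    by (simp add: ultrafilter_name_extending_def forces_imp)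
  with \<open>F\<^sub>0 \<subseteq> M\<close> show ?thesis by blast
qed

section \<open>The equivalence for a single ultrafilter\<close>

text \<open>Intersecting with \<open>K\<close> covers the empty family, whose intersection is the
  whole type.\<close>

lemma ultrafilter_on_finite_Inter:
  assumes "ultrafilter_on K D" "finite \<Y>" "\<Y> \<subseteq> D"
  shows "K \<inter> \<Inter>\<Y> \<in> D"
  using assms(2,3)
proof (induction rule: finite_induct)
  case empty
  then show ?case using assms(1) by (simp add: ultrafilter_on_def)
next
  case (insert Y \<Y>)
  then have "Y \<in> D" "K \<inter> \<Inter>\<Y> \<in> D" by auto
  then have "Y \<inter> (K \<inter> \<Inter>\<Y>) \<in> D"
    using assms(1) by (simp add: ultrafilter_on_def)
  then show ?case by (simp add: Int_left_commute)
qed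

definition ratio_name :: "'k set \<Rightarrow> ('k \<Rightarrow> 'l set) \<Rightarrow> real \<Rightarrow> ('l \<Rightarrow> 'p::preorder) \<Rightarrow> ('k, 'p) name"
  where "ratio_name K I \<epsilon> r = fcollect K (\<lambda>k. fratio_ge (I k) r (1 - \<epsilon>))"

lemma forces_mem_ratio_name:
  "(p \<tturnstile> k \<^bold>\<in> ratio_name K I \<epsilon> r) \<longleftrightarrow> k \<in> K \<and> (p \<tturnstile> fratio_ge (I k) r (1 - \<epsilon>))"
  by (simp add: ratio_name_def forces_mem_collect)

text \<open>
  In the next two lemmas \<open>T\<close> is the set of admissible indices \<open>(\<alpha>, \<epsilon>, r)\<close> and \<open>lm\<close>, \<open>eps\<close>, \<open>seq\<close> give
  the limit, the \<open>\<epsilon>\<close> and the sequence of an index.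
\<close>

lemma ultrafilter_name_imp_combinatorial:
  fixes K :: "'k set" and lm :: "'t \<Rightarrow> 'p::preorder" and eps :: "'t \<Rightarrow> real" and seq :: "'t \<Rightarrow> 'l \<Rightarrow> 'p"
    and n :: nat
  assumes fin: "\<And>k. k \<in> K \<Longrightarrow> finite (I k)"
    and D': "ultrafilter_name_extending K D D'"
    and lim: "\<And>t. t \<in> T \<Longrightarrow> lm t \<tturnstile> ratio_name K I (eps t) (seq t) \<^bold>\<in>\<^bold>\<in> D'"
    and t: "\<And>i. i < n \<Longrightarrow> t i \<in> T" and "a \<in> D" and q: "\<And>i. i < n \<Longrightarrow> q \<le> lm (t i)"
    and "D \<subseteq> Pow K"
  shows "\<exists>q'\<le>q. \<exists>k\<in>a. \<forall>i<n.
    real (card {l \<in> I k. q' \<le> seq (t i) l}) / real (card (I k)) \<ge> 1 - eps (t i)"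
proof -
  have "q \<tturnstile> fultrafilter_on K D'"
    using D' by (simp add: ultrafilter_name_extending_def)
  moreover have "q \<tturnstile> check a \<^bold>\<in>\<^bold>\<in> D'"
  proof -
    have "q \<tturnstile> check a \<^bold>\<in>\<^bold>\<in> Check D"
      using \<open>a \<in> D\<close> by (intro forces_MemI[of _ q]) (auto simp: Check_def)
    then show ?thesis
      using D' by (auto simp: ultrafilter_name_extending_def forces_imp)
  qed
  moreover have "q \<tturnstile> ratio_name K I (eps (t i)) (seq (t i)) \<^bold>\<in>\<^bold>\<in> D'" if "i < n" for i
    using forces_mono[OF _ lim[OF t[OF that]] q[OF that]] by simp
  ultimately obtain q' k where q': "q' \<le> q" "q' \<tturnstile> k \<^bold>\<in> check a"
    "\<forall>i<n. q' \<tturnstile> k \<^bold>\<in> ratio_name K I (eps (t i)) (seq (t i))"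
    using ultrafilter_name_finite_Int[of q K D' "check a" n "\<lambda>i. ratio_name K I (eps (t i)) (seq (t i))"]
    by blast
  then have "k \<in> a" "k \<in> K"
    using \<open>a \<in> D\<close> \<open>D \<subseteq> Pow K\<close> by auto
  moreover have "\<exists>r\<le>q'. \<forall>i<n. real (card {l \<in> I k. r \<le> seq (t i) l}) / real (card (I k)) \<ge> 1 - eps (t i)"
    using exists_common_ratio_ge[of "I k" n q' "\<lambda>i. seq (t i)" "\<lambda>i. 1 - eps (t i)"]
      fin[OF \<open>k \<in> K\<close>] q'(3) by (auto simp: forces_mem_ratio_name)
  ultimately show ?thesis
    using q'(1) order_trans by blast
qed

lemma combinatorial_imp_ultrafilter_name:
  fixes K :: "'k set" and lm :: "'t \<Rightarrow> 'p::preorder" and eps :: "'t \<Rightarrow> real" and seq :: "'t \<Rightarrow> 'l \<Rightarrow> 'p"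
  assumes D: "ultrafilter_on K D" and fin: "\<And>k. k \<in> K \<Longrightarrow> finite (I k)"
    and comb: "\<And>(n::nat) t a q. (\<And>i. i < n \<Longrightarrow> t i \<in> T) \<Longrightarrow> a \<in> D \<Longrightarrow> (\<And>i. i < n \<Longrightarrow> q \<le> lm (t i)) \<Longrightarrow>
      \<exists>q'\<le>q. \<exists>k\<in>a. \<forall>i<n.
        real (card {l \<in> I k. q' \<le> seq (t i) l}) / real (card (I k)) \<ge> 1 - eps (t i)"
  shows "\<exists>D'. ultrafilter_name_extending K D D' \<and>
    (\<forall>t\<in>T. lm t \<tturnstile> ratio_name K I (eps t) (seq t) \<^bold>\<in>\<^bold>\<in> D')"
proof -
  define F\<^sub>D :: "(('k, 'p) name, 'p) name" where "F\<^sub>D = {(check Y, p) | Y p. Y \<in> D}"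
  define F\<^sub>T where "F\<^sub>T = {(ratio_name K I (eps t) (seq t), p) | t p. t \<in> T \<and> p \<le> lm t}"
  have DK: "D \<subseteq> Pow K" "K \<in> D"
    using D by (auto simp: ultrafilter_on_def)
  have "centred_name K (F\<^sub>D \<union> F\<^sub>T)"
    unfolding centred_name_def
  proof (intro conjI allI impI)
    show "\<forall>(X, s)\<in>F\<^sub>D \<union> F\<^sub>T. s \<tturnstile> X \<^bold>\<subseteq> check K"
      using DK(1) by (fastforce simp: F\<^sub>D_def F\<^sub>T_def forces_subset forces_mem_ratio_name)
  next
    fix S p assume S: "finite S \<and> S \<subseteq> F\<^sub>D \<union> F\<^sub>T \<and> (\<forall>(X, s)\<in>S. p \<le> s)"
    have "\<exists>Y\<in>D. fst x = check Y" if "x \<in> S \<inter> F\<^sub>D" for x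
      using that by (auto simp: F\<^sub>D_def)
    then obtain Y where Y: "\<And>x. x \<in> S \<inter> F\<^sub>D \<Longrightarrow> Y x \<in> D \<and> fst x = check (Y x)"
      by metis
    \<comment> \<open>The second component of a pair in \<open>F\<^sub>T\<close> lies below its
      limit, and \<open>p\<close> lies below that component.\<close>
    have "\<exists>t\<in>T. fst x = ratio_name K I (eps t) (seq t) \<and> p \<le> lm t" if "x \<in> S \<inter> F\<^sub>T" for x
      using that S by (fastforce simp: F\<^sub>T_def intro: order_trans)
    then obtain t where t: "\<And>x. x \<in> S \<inter> F\<^sub>T \<Longrightarrow>
        t x \<in> T \<and> fst x = ratio_name K I (eps (t x)) (seq (t x)) \<and> p \<le> lm (t x)"
      by metis
    \<comment> \<open>\<open>comb\<close> speaks of sequences indexed by the numbers below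
      \<open>n\<close>, so the finite set is enumerated.\<close>
    obtain e and n :: nat where e: "S \<inter> F\<^sub>T = e ` {i. i < n}"
      using S finite_imp_nat_seg_image_inj_on[of "S \<inter> F\<^sub>T"] by auto
    \<comment> \<open>All members of \<open>D\<close> named in \<open>S\<close> are merged into the
      single set that \<open>comb\<close> accepts; the factor \<open>K\<close> also gives
      \<open>k \<in> K\<close> below.\<close>
    define a where "a = K \<inter> \<Inter>(Y ` (S \<inter> F\<^sub>D))"
    have "a \<in> D"
      unfolding a_def by (rule ultrafilter_on_finite_Inter[OF D]) (use S Y in auto)
    moreover have te: "t (e i) \<in> T" "p \<le> lm (t (e i))" if "i < n" for i
      using t[of "e i"] e that by auto
    ultimately obtain q k where q: "q \<le> p" "k \<in> a" "\<forall>i<n.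
        real (card {l \<in> I k. q \<le> seq (t (e i)) l}) / real (card (I k)) \<ge> 1 - eps (t (e i))"
      using comb[of n "\<lambda>i. t (e i)" a p] by blast
    have "k \<in> K"
      using q(2) by (simp add: a_def)
    have "q \<tturnstile> k \<^bold>\<in> fst x" if "x \<in> S" for x
    proof (cases "x \<in> F\<^sub>D")
      case True
      then show ?thesis
        using Y[of x] that q(2) by (auto simp: a_def)
    next
      case False
      then have x: "x \<in> S \<inter> F\<^sub>T"
        using that S by auto
      then obtain i where "i < n" "x = e i"
        using e by auto
      then have "q \<tturnstile> fratio_ge (I k) (seq (t x)) (1 - eps (t x))"
        using q(3) fin[OF \<open>k \<in> K\<close>] by (auto intro: forces_ratio_geI)
      then show ?thesis
        using t[OF x] \<open>k \<in> K\<close> by (simp add: forces_mem_ratio_name)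
    qed
    then show "\<exists>q\<le>p. \<exists>k\<in>K. \<forall>(X, s)\<in>S. q \<tturnstile> k \<^bold>\<in> X"
      using q(1) \<open>k \<in> K\<close> by fastforce
  qed
  then obtain M where M: "F\<^sub>D \<union> F\<^sub>T \<subseteq> M" "ultrafilter_name_extending K D M"
    using centred_name_extends[of K "F\<^sub>D \<union> F\<^sub>T" D] DK(2) by (auto simp: F\<^sub>D_def)
  have "lm t \<tturnstile> ratio_name K I (eps t) (seq t) \<^bold>\<in>\<^bold>\<in> M" if "t \<in> T" for t
    by (rule forces_MemI[of _ "lm t"]) (use M(1) that in \<open>auto simp: F\<^sub>T_def\<close>)
  with M(2) show ?thesis by blast
qed

theorem theorem4p4:
  fixes \<mu> :: "'m rel"
    and Q :: "'m \<Rightarrow> real \<Rightarrow> 'p::preorder set"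
    and \<D> :: "('k, 'l) ufam set"
    and limf :: "('k, 'l) ufam \<Rightarrow> 'm \<Rightarrow> real \<Rightarrow> ('l \<Rightarrow> 'p) \<Rightarrow> 'p"
  assumes "Card_order \<mu>"
    and "\<D> \<subseteq> D_star"
  shows "uniformly_linked_witnessed \<mu> \<D> Q limf \<longleftrightarrow>
    (\<forall>\<epsilon>\<in>rat_unit. dense_in_poset (\<Union>\<alpha>\<in>Field \<mu>. Q \<alpha> \<epsilon>)) \<and>
    (\<forall>(K, D, I)\<in>\<D>. \<forall>(n::nat) (\<alpha> :: nat \<Rightarrow> 'm) (\<epsilon> :: nat \<Rightarrow> real) (r :: nat \<Rightarrow> 'l \<Rightarrow> 'p).
      (\<forall>i<n. \<alpha> i \<in> Field \<mu> \<and> \<epsilon> i \<in> rat_unit \<and> r i \<in> (\<Union>k\<in>K. I k) \<rightarrow>\<^sub>E Q (\<alpha> i) (\<epsilon> i)) \<longrightarrow>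
      (\<forall>a\<in>D. \<forall>q::'p. (\<forall>i<n. q \<le> limf (K, D, I) (\<alpha> i) (\<epsilon> i) (r i)) \<longrightarrow>
        (\<exists>q'\<le>q. \<exists>k\<in>a. \<forall>i<n.
           real (card {l \<in> I k. q' \<le> r i l}) / real (card (I k)) \<ge> 1 - \<epsilon> i)))"
proof -
  \<comment> \<open>Density is the same conjunct on both sides, so it suffices to compare the
    remaining conjuncts for each triple separately.\<close>
  have equiv: "(\<exists>D' :: (('k, 'p) name, 'p) name. ultrafilter_name_extending K D D' \<and>
      (\<forall>\<alpha>\<in>Field \<mu>. \<forall>\<epsilon>\<in>rat_unit. \<forall>p \<in> (\<Union>k\<in>K. I k) \<rightarrow>\<^sub>E Q \<alpha> \<epsilon>.
         limf (K, D, I) \<alpha> \<epsilon> p \<tturnstile> fcollect K (\<lambda>k. fratio_ge (I k) p (1 - \<epsilon>)) \<^bold>\<in>\<^bold>\<in> D')) \<longleftrightarrow>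
    (\<forall>(n::nat) (\<alpha> :: nat \<Rightarrow> 'm) (\<epsilon> :: nat \<Rightarrow> real) (r :: nat \<Rightarrow> 'l \<Rightarrow> 'p).
      (\<forall>i<n. \<alpha> i \<in> Field \<mu> \<and> \<epsilon> i \<in> rat_unit \<and> r i \<in> (\<Union>k\<in>K. I k) \<rightarrow>\<^sub>E Q (\<alpha> i) (\<epsilon> i)) \<longrightarrow>
      (\<forall>a\<in>D. \<forall>q::'p. (\<forall>i<n. q \<le> limf (K, D, I) (\<alpha> i) (\<epsilon> i) (r i)) \<longrightarrow>
        (\<exists>q'\<le>q. \<exists>k\<in>a. \<forall>i<n.
           real (card {l \<in> I k. q' \<le> r i l}) / real (card (I k)) \<ge> 1 - \<epsilon> i)))"
    (is "?linked \<longleftrightarrow> ?comb") if "(K, D, I) \<in> \<D>" for K D I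
  proof -
    have D: "ultrafilter_on K D" and fin: "\<And>k. k \<in> K \<Longrightarrow> finite (I k)"
      using that assms(2) by (auto simp: D_star_def)
    then have DK: "D \<subseteq> Pow K"
      by (simp add: ultrafilter_on_def)
    \<comment> \<open>Bundling \<open>\<alpha>\<close>, \<open>\<epsilon>\<close> and the sequence
      into one index brings both sides into the form of the two preceding lemmas.\<close>
    define T where "T = {(\<alpha>, \<epsilon>, r). \<alpha> \<in> Field \<mu> \<and> \<epsilon> \<in> rat_unit \<and> r \<in> (\<Union>k\<in>K. I k) \<rightarrow>\<^sub>E Q \<alpha> \<epsilon>}"
    define lm where "lm = (\<lambda>(\<alpha>, \<epsilon>, r). limf (K, D, I) \<alpha> \<epsilon> r)"
    define eps where "eps = (\<lambda>(\<alpha>::'m, \<epsilon>::real, r::'l \<Rightarrow> 'p). \<epsilon>)"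
    define seq where "seq = (\<lambda>(\<alpha>::'m, \<epsilon>::real, r::'l \<Rightarrow> 'p). r)"
    show ?thesis
    proof
      assume ?linked
      then obtain D' :: "(('k, 'p) name, 'p) name" where D': "ultrafilter_name_extending K D D'"
        "\<And>t. t \<in> T \<Longrightarrow> lm t \<tturnstile> ratio_name K I (eps t) (seq t) \<^bold>\<in>\<^bold>\<in> D'"
        unfolding T_def lm_def eps_def seq_def ratio_name_def by fast
      show ?comb
      proof (intro allI impI ballI)
        fix n :: nat and \<alpha> \<epsilon> r a and q :: 'p
        assume *: "\<forall>i<n. \<alpha> i \<in> Field \<mu> \<and> \<epsilon> i \<in> rat_unit \<and> r i \<in> (\<Union>k\<in>K. I k) \<rightarrow>\<^sub>E Q (\<alpha> i) (\<epsilon> i)"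
          "a \<in> D" "\<forall>i<n. q \<le> limf (K, D, I) (\<alpha> i) (\<epsilon> i) (r i)"
        have "(\<alpha> i, \<epsilon> i, r i) \<in> T" "q \<le> lm (\<alpha> i, \<epsilon> i, r i)" if "i < n" for i
          using * that by (auto simp: T_def lm_def)
        from ultrafilter_name_imp_combinatorial[where t = "\<lambda>i. (\<alpha> i, \<epsilon> i, r i)" and n = n and q = q
            and I = I and lm = lm and T = T and eps = eps and seq = seq,
            OF fin D' this(1) *(2) this(2) DK]
        show "\<exists>q'\<le>q. \<exists>k\<in>a. \<forall>i<n. real (card {l \<in> I k. q' \<le> r i l}) / real (card (I k)) \<ge> 1 - \<epsilon> i"
          by (simp add: eps_def seq_def)
      qed
    next
      assume comb: ?comb
      have "\<exists>D' :: (('k, 'p) name, 'p) name. ultrafilter_name_extending K D D' \<and>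
          (\<forall>t\<in>T. lm t \<tturnstile> ratio_name K I (eps t) (seq t) \<^bold>\<in>\<^bold>\<in> D')"
      proof (rule combinatorial_imp_ultrafilter_name[OF D fin])
        fix n :: nat and a and t :: "nat \<Rightarrow> 'm \<times> real \<times> ('l \<Rightarrow> 'p)" and q :: 'p
        assume *: "\<And>i. i < n \<Longrightarrow> t i \<in> T" "a \<in> D" "\<And>i. i < n \<Longrightarrow> q \<le> lm (t i)"
        have "\<forall>i<n. fst (t i) \<in> Field \<mu> \<and> fst (snd (t i)) \<in> rat_unit \<and>
            snd (snd (t i)) \<in> (\<Union>k\<in>K. I k) \<rightarrow>\<^sub>E Q (fst (t i)) (fst (snd (t i)))"
          using *(1) unfolding T_def by (simp add: split_beta)
        moreover have "\<forall>i<n. q \<le> limf (K, D, I) (fst (t i)) (fst (snd (t i))) (snd (snd (t i)))"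
          using *(3) by (simp add: lm_def split_beta)
        ultimately show "\<exists>q'\<le>q. \<exists>k\<in>a. \<forall>i<n.
            real (card {l \<in> I k. q' \<le> seq (t i) l}) / real (card (I k)) \<ge> 1 - eps (t i)"
          using comb[rule_format, of n "\<lambda>i. fst (t i)" "\<lambda>i. fst (snd (t i))" "\<lambda>i. snd (snd (t i))" a q]
            *(2) by (simp add: seq_def eps_def split_beta)
      qed
      then show ?linked
        by (simp add: T_def lm_def eps_def seq_def ratio_name_def Ball_def imp_conjL)
    qed
  qed
  show ?thesis
    unfolding uniformly_linked_witnessed_def
    by (rule conj_cong[OF refl], rule ball_cong[OF refl])
      (simp only: split_paired_all prod.case, rule equiv)
qed

end
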